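(* Let $\mathcal X$ and $\mathcal Y$ be complex Banach spaces and let $A\in\mathcal B(\mathcal X)$, $B\in\mathcal B(\mathcal Y)$. There exists a polynomial $p$ with complex coefficients such that $$\sigma(p(A))\subset\mathbb C_{+}\quad\text{and}\quad \sigma(p(B))\subset\mathbb C_{-}$$ if and only if $$\widehat{\sigma(A)}\cap\widehat{\sigma(B)}=\emptyset .$$
   Context: $\mathcal B(\mathcal X)$ denotes the bounded linear operators on $\mathcal X$, and $\sigma(T)$ the spectrum of $T$. $\mathbb C_+$ is the open right half plane and $\mathbb C_-$ the open left half plane. For compact $K\subset\mathbb C$, $\widehat K$ is the polynomially convex hull $\widehat K=\{z\in\mathbb C: |p(z)|\le\sup_{\zeta\in K}|p(\zeta)|\text{ for all polynomials }p\}$. *)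

theory Defs
  imports "HOL-Analysis.Analysis" "HOL-Computational_Algebra.Polynomial"
begin

(* The real Banach space structure is inherited from class banach; the complex scalar
   multiplication extends the real one and the norm is homogeneous over the complex numbers.
   The zero space is not excluded. *)
class complex_banach = banach +
  fixes scaleC :: "complex \<Rightarrow> 'a \<Rightarrow> 'a"  (infixr "*\<^sub>C" 75)
  assumes scaleC_add_right: "c *\<^sub>C (x + y) = c *\<^sub>C x + c *\<^sub>C y"
    and scaleC_add_left: "(c + d) *\<^sub>C x = c *\<^sub>C x + d *\<^sub>C x"
    and scaleC_scaleC: "c *\<^sub>C d *\<^sub>C x = (c * d) *\<^sub>C x"
    and scaleC_one: "1 *\<^sub>C x = x"
    and scaleC_of_real: "complex_of_real r *\<^sub>C x = r *\<^sub>R x"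
    and norm_scaleC: "norm (c *\<^sub>C x) = cmod c * norm x"

definition bounded_operators :: "('a::complex_banach \<Rightarrow> 'a) set" where
  "bounded_operators =
     {T. Vector_Spaces.linear scaleC scaleC T \<and> (\<exists>M. \<forall>x. norm (T x) \<le> M * norm x)}"

definition spectrum :: "('a::complex_banach \<Rightarrow> 'a) \<Rightarrow> complex set" where
  "spectrum T =
     {z. \<not> (\<exists>S\<in>bounded_operators.
              S \<circ> (\<lambda>x. T x - z *\<^sub>C x) = id \<and> (\<lambda>x. T x - z *\<^sub>C x) \<circ> S = id)}"

definition poly_op :: "complex poly \<Rightarrow> ('a::complex_banach \<Rightarrow> 'a) \<Rightarrow> 'a \<Rightarrow> 'a" where
  "poly_op p T = (\<lambda>x. \<Sum>i\<le>degree p. coeff p i *\<^sub>C (T ^^ i) x)"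

(* For K = {} the real supremum is an unspecified number, but the hull is still empty,
   since a constant polynomial can exceed that number. *)
definition polynomial_hull :: "complex set \<Rightarrow> complex set" where
  "polynomial_hull K =
     {z. \<forall>p :: complex poly. cmod (poly p z) \<le> (SUP w\<in>K. cmod (poly p w))}"

end

theory Submission
  imports Defs "HOL-Complex_Analysis.Complex_Analysis"
    "HOL-Computational_Algebra.Fundamental_Theorem_Algebra"
begin

text \<open>
  By spectral mapping, the question is whether some polynomial maps \<open>\<sigma>(A)\<close> and \<open>\<sigma>(B)\<close> into
  opposite half planes. Such a polynomial separates the hulls as well, because a compact subset of
  a half plane lies in a disc inside that half plane. Conversely, let the hulls \<open>K\<close> and \<open>L\<close> be
  disjoint. By Janiszewski's theorem \<open>K \<union> L\<close> has connected complement, so pole pushing makes every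
  \<open>1 / (z - b)\<close> with \<open>b \<notin> K \<union> L\<close> a uniform limit of polynomials on \<open>K \<union> L\<close>. A set
  \<open>{|p\<^sub>1| < 1, \<dots>, |p\<^sub>n| < 1}\<close> that contains \<open>K\<close> and misses \<open>L\<close> has simply connected components by
  the maximum principle; a Riemann map of a component yields a Cauchy integral
  that equals \<open>1\<close> on the part of \<open>K\<close> inside it and \<open>0\<close> elsewhere on \<open>K \<union> L\<close>. Finitely many such
  integrals add up to the indicator of \<open>K\<close>, and Riemann sums approximate them by polynomials.
\<close>

subsection \<open>Bounded operators and spectral mapping\<close>

interpretation scaleC: vector_space "scaleC :: complex \<Rightarrow> 'a::complex_banach \<Rightarrow> 'a"
  by unfold_locales (simp_all add: scaleC_add_right scaleC_add_left scaleC_scaleC scaleC_one)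

lemma bounded_operators_iff:
  "T \<in> bounded_operators \<longleftrightarrow>
     (\<forall>x y. T (x + y) = T x + T y) \<and> (\<forall>c x. T (c *\<^sub>C x) = c *\<^sub>C T x) \<and>
     (\<exists>M. \<forall>x. norm (T x) \<le> M * norm (x::'a::complex_banach))"
  unfolding bounded_operators_def
  by (simp add: Vector_Spaces.linear_iff scaleC.vector_space_axioms)

lemma bounded_operators_bound:
  assumes "T \<in> bounded_operators"
  obtains M where "M > 0" "\<And>x. norm (T x) \<le> M * norm x"
proof -
  obtain M where M: "norm (T x) \<le> M * norm x" for x
    using assms by (auto simp: bounded_operators_iff)
  show thesis
  proof
    \<comment> \<open>The given bound may be zero or negative; enlarging it to at least 1 allows
      later divisions by it.\<close>
    show "max M 1 > 0" by simp
    show "norm (T x) \<le> max M 1 * norm x" for x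
      using M[of x] by (meson max.cobounded1 mult_right_mono norm_ge_zero order_trans)
  qed
qed

lemma bounded_operators_add: "T \<in> bounded_operators \<Longrightarrow> T (x + y) = T x + T y"
  and bounded_operators_scaleC: "T \<in> bounded_operators \<Longrightarrow> T (c *\<^sub>C x) = c *\<^sub>C T x"
  by (auto simp: bounded_operators_iff)

lemma bounded_operators_zero: "T \<in> bounded_operators \<Longrightarrow> T 0 = 0"
  by (metis bounded_operators_scaleC scaleC.scale_zero_left)

lemma bounded_operators_diff: "T \<in> bounded_operators \<Longrightarrow> T (x - y) = T x - T y"
  by (metis add_diff_cancel bounded_operators_add diff_add_cancel)

lemma bounded_operators_comp:
  assumes "S \<in> bounded_operators" "T \<in> bounded_operators"
  shows "S \<circ> T \<in> bounded_operators"
proof -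
  obtain M where M: "M > 0" "\<And>x. norm (S x) \<le> M * norm x"
    using bounded_operators_bound[OF assms(1)] by blast
  obtain N where N: "N > 0" "\<And>x. norm (T x) \<le> N * norm x"
    using bounded_operators_bound[OF assms(2)] by blast
  have "norm (S (T x)) \<le> (M * N) * norm x" for x
    using order_trans[OF M(2)[of "T x"] mult_left_mono[OF N(2)[of x], of M]] M(1) by (simp add: mult.assoc)
  with assms show ?thesis
    by (auto simp: bounded_operators_iff)
qed

lemma bounded_operators_plus:
  assumes "S \<in> bounded_operators" "T \<in> bounded_operators"
  shows "(\<lambda>x. S x + T x) \<in> bounded_operators"
proof -
  obtain M where M: "M > 0" "\<And>x. norm (S x) \<le> M * norm x"
    using bounded_operators_bound[OF assms(1)] by blast
  obtain N where N: "N > 0" "\<And>x. norm (T x) \<le> N * norm x"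
    using bounded_operators_bound[OF assms(2)] by blast
  have "norm (S x + T x) \<le> (M + N) * norm x" for x
    using norm_triangle_mono[OF M(2)[of x] N(2)[of x]] by (simp add: distrib_right)
  with assms show ?thesis
    by (auto simp: bounded_operators_iff scaleC_add_right)
qed

lemma bounded_operators_scale: "(\<lambda>x. c *\<^sub>C x) \<in> bounded_operators"
  by (auto simp: bounded_operators_iff scaleC_add_right scaleC_scaleC mult.commute norm_scaleC
      intro!: exI[of _ "cmod c"])

section \<open>Invertible operators and the spectrum\<close>

definition invertible_operator :: "('a::complex_banach \<Rightarrow> 'a) \<Rightarrow> bool" where
  "invertible_operator T \<longleftrightarrow> (\<exists>S\<in>bounded_operators. S \<circ> T = id \<and> T \<circ> S = id)"

lemma spectrum_iff: "z \<in> spectrum T \<longleftrightarrow> \<not> invertible_operator (\<lambda>x. T x - z *\<^sub>C x)"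
  by (simp add: spectrum_def invertible_operator_def)

lemma invertible_operator_comp:
  assumes "invertible_operator S" "invertible_operator T"
  shows "invertible_operator (S \<circ> T)"
proof -
  obtain S' T' where "S' \<in> bounded_operators" "S' \<circ> S = id" "S \<circ> S' = id"
    "T' \<in> bounded_operators" "T' \<circ> T = id" "T \<circ> T' = id"
    using assms by (auto simp: invertible_operator_def)
  then show ?thesis
    unfolding invertible_operator_def
    by (intro bexI[of _ "T' \<circ> S'"])
       (simp_all add: fun_eq_iff bounded_operators_comp)
qed

lemma invertible_operator_scale:
  assumes "c \<noteq> 0"
  shows "invertible_operator (\<lambda>x. c *\<^sub>C x)"
  unfolding invertible_operator_def
  using assms
  by (intro bexI[of _ "\<lambda>x. (1 / c) *\<^sub>C x"])
     (auto simp: fun_eq_iff scaleC_scaleC scaleC_one bounded_operators_scale)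

text \<open>If \<open>S\<close> inverts the product, \<open>Q \<circ> S\<close> is a right inverse
  of \<open>T\<close>, and by commutation \<open>S \<circ> Q\<close> is a left inverse. One-sided
  inverses on both sides coincide.\<close>

lemma invertible_operator_cancel_left:
  assumes T: "T \<in> bounded_operators" and Q: "Q \<in> bounded_operators"
    and comm: "T \<circ> Q = Q \<circ> T" and inv: "invertible_operator (T \<circ> Q)"
  shows "invertible_operator T"
proof -
  obtain S where S: "S \<in> bounded_operators" "S \<circ> (T \<circ> Q) = id" "(T \<circ> Q) \<circ> S = id"
    using inv by (auto simp: invertible_operator_def)
  have right: "T \<circ> (Q \<circ> S) = id"
    using S(3) by (simp add: comp_assoc)
  have left: "(S \<circ> Q) \<circ> T = id"
    using S(2) comm by (simp add: comp_assoc)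
  have "Q \<circ> S = S \<circ> Q"
    using left right by (metis comp_assoc comp_id id_comp)
  then show ?thesis
    unfolding invertible_operator_def
    using left right S(1) Q by (metis bounded_operators_comp)
qed

text \<open>The equation \<open>x = y + N x\<close> is solved by the contraction principle.\<close>

lemma invertible_operator_id_minus:
  fixes N :: "'a::complex_banach \<Rightarrow> 'a"
  assumes N: "N \<in> bounded_operators" and M: "M < 1" "\<And>x. norm (N x) \<le> M * norm x"
  shows "invertible_operator (\<lambda>x. x - N x)"
proof -
  \<comment> \<open>The contraction principle wants a nonnegative factor, while \<open>M\<close> may
    be negative.\<close>
  define c where "c = max M 0"
  have c: "0 \<le> c" "c < 1" and cN: "norm (N x) \<le> c * norm x" for x
    using M(1) order_trans[OF M(2)[of x] mult_right_mono[of M c "norm x"]] by (auto simp: c_def)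
  have "\<exists>!x. x \<in> UNIV \<and> y + N x = x" for y
  proof (rule Banach_fix)
    show "complete (UNIV :: 'a set)" by (rule complete_UNIV)
    show "dist (y + N x) (y + N x') \<le> c * dist x x'" for x x'
      using cN[of "x - x'"] by (simp add: dist_norm bounded_operators_diff[OF N])
  qed (use c in auto)
  then have ex1: "\<exists>!x. x - N x = y" for y
    by (metis UNIV_I add_diff_cancel_right' diff_add_cancel)
  define S where "S y = (THE x. x - N x = y)" for y
  have S: "S y - N (S y) = y" for y
    unfolding S_def by (rule theI'[OF ex1])
  have S_eq: "S y = x" if "x - N x = y" for x y
    using ex1 S that by metis
  have bound: "norm (S y) \<le> (1 / (1 - c)) * norm y" for y
  proof -
    have "norm (S y) - norm (N (S y)) \<le> norm y"
      using norm_triangle_ineq2[of "S y" "N (S y)"] S[of y] by simp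
    then have "(1 - c) * norm (S y) \<le> norm y"
      using cN[of "S y"] by (simp add: algebra_simps)
    then show ?thesis
      using c by (simp add: field_simps)
  qed
  have "S (x + y) = S x + S y" for x y
    using S[of x] S[of y] by (intro S_eq) (simp add: bounded_operators_add[OF N] add_diff_add)
  moreover have "S (d *\<^sub>C x) = d *\<^sub>C S x" for d x
    using S[of x] by (intro S_eq)
      (simp add: bounded_operators_scaleC[OF N] flip: scaleC.scale_right_diff_distrib)
  ultimately have "S \<in> bounded_operators"
    using bound unfolding bounded_operators_iff by blast
  then show ?thesis
    unfolding invertible_operator_def
    by (intro bexI[of _ S]) (auto simp: fun_eq_iff S S_eq)
qed

text \<open>For \<open>cmod z > M\<close> write T - z = -z (I - T/z), where T/z has norm below
  1.\<close>

lemma spectrum_bounded: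
  fixes T :: "'a::complex_banach \<Rightarrow> 'a"
  assumes "M \<ge> 0" "\<And>x. norm (T x) \<le> M * norm x" "T \<in> bounded_operators" "z \<in> spectrum T"
  shows "cmod z \<le> M"
proof (rule ccontr)
  assume "\<not> cmod z \<le> M"
  then have z: "cmod z > M" "z \<noteq> 0"
    using assms(1) by auto
  define N where "N = (\<lambda>x. (1 / z) *\<^sub>C x) \<circ> T"
  have "N \<in> bounded_operators"
    unfolding N_def by (intro bounded_operators_comp bounded_operators_scale assms(3))
  moreover have "norm (N x) \<le> (M / cmod z) * norm x" for x
    using assms(2)[of x] z by (simp add: N_def norm_scaleC norm_divide field_simps)
  moreover have "M / cmod z < 1"
    using z by simp
  ultimately have "invertible_operator (\<lambda>x. x - N x)"
    using invertible_operator_id_minus by blast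
  then have "invertible_operator ((\<lambda>x. (- z) *\<^sub>C x) \<circ> (\<lambda>x. x - N x))"
    using z by (intro invertible_operator_comp invertible_operator_scale) auto
  moreover have "(\<lambda>x. (- z) *\<^sub>C x) \<circ> (\<lambda>x. x - N x) = (\<lambda>x. T x - z *\<^sub>C x)"
    using z by (auto simp: fun_eq_iff N_def scaleC.scale_right_diff_distrib scaleC_scaleC)
  ultimately show False using assms(4) by (simp add: spectrum_iff)
qed

text \<open>If \<open>S\<close> inverts T - z, then T - w = (I - (w - z) S)(T - z), and the first
  factor is invertible as soon as (w - z) S has norm below 1.\<close>

lemma open_resolvent_set:
  assumes T: "T \<in> bounded_operators"
  shows "open (- spectrum T)"
  unfolding open_dist
proof
  fix z assume "z \<in> - spectrum T"
  then obtain S where S: "S \<in> bounded_operators"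
      "S \<circ> (\<lambda>x. T x - z *\<^sub>C x) = id" "(\<lambda>x. T x - z *\<^sub>C x) \<circ> S = id"
    by (auto simp: spectrum_def)
  obtain M where M: "M > 0" "\<And>x. norm (S x) \<le> M * norm x"
    using bounded_operators_bound[OF S(1)] by blast
  have "w \<in> - spectrum T" if w: "dist w z < 1 / M" for w
  proof -
    define N where "N = (\<lambda>x. (w - z) *\<^sub>C x) \<circ> S"
    have "N \<in> bounded_operators"
      unfolding N_def by (intro bounded_operators_comp bounded_operators_scale S)
    moreover have "norm (N x) \<le> (cmod (w - z) * M) * norm x" for x
      using mult_left_mono[OF M(2)[of x], of "cmod (w - z)"] by (simp add: N_def norm_scaleC mult.assoc)
    moreover have "cmod (w - z) * M < 1"
      using w M(1) by (simp add: dist_norm field_simps)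
    ultimately have "invertible_operator (\<lambda>x. x - N x)"
      using invertible_operator_id_minus by blast
    moreover have "invertible_operator (\<lambda>x. T x - z *\<^sub>C x)"
      using S by (auto simp: invertible_operator_def)
    ultimately have "invertible_operator ((\<lambda>x. x - N x) \<circ> (\<lambda>x. T x - z *\<^sub>C x))"
      by (rule invertible_operator_comp)
    moreover have "(\<lambda>x. x - N x) \<circ> (\<lambda>x. T x - z *\<^sub>C x) = (\<lambda>x. T x - w *\<^sub>C x)"
      using S(2) by (auto simp: fun_eq_iff N_def scaleC.scale_left_diff_distrib)
    ultimately show ?thesis
      by (simp add: spectrum_iff)
  qed
  then show "\<exists>e>0. \<forall>w. dist w z < e \<longrightarrow> w \<in> - spectrum T"
    using M(1) by (intro exI[of _ "1 / M"]) auto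
qed

lemma compact_spectrum:
  assumes "T \<in> bounded_operators"
  shows "compact (spectrum T)"
proof -
  obtain M where "M > 0" "\<And>x. norm (T x) \<le> M * norm x"
    using bounded_operators_bound[OF assms] by blast
  then have "bounded (spectrum T)"
    using spectrum_bounded[OF _ _ assms] unfolding bounded_iff by (meson less_imp_le)
  then show ?thesis
    using open_resolvent_set[OF assms] by (simp add: compact_eq_bounded_closed closed_def)
qed

section \<open>Polynomials of an operator and spectral mapping\<close>

lemma poly_op_degree_le:
  assumes "degree p \<le> n"
  shows "poly_op p T x = (\<Sum>i\<le>n. coeff p i *\<^sub>C (T ^^ i) x)"
  unfolding poly_op_def
  by (rule sum.mono_neutral_left) (use assms in \<open>auto simp: coeff_eq_0\<close>)

lemma poly_op_0 [simp]: "poly_op 0 T = (\<lambda>x. 0)"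
  by (simp add: poly_op_def)

lemma poly_op_add: "poly_op (p + q) T x = poly_op p T x + poly_op q T x"
proof -
  define n where "n = max (degree p) (degree q)"
  show ?thesis
    by (simp add: poly_op_degree_le[of _ n] degree_add_le n_def scaleC_add_left sum.distrib)
qed

lemma poly_op_smult: "poly_op (smult c p) T x = c *\<^sub>C poly_op p T x"
  by (simp add: poly_op_degree_le[of _ "degree p"] degree_smult_le scaleC.scale_sum_right scaleC_scaleC)

text \<open>Horner's recursion, which carries the inductions over polynomials below.\<close>

lemma poly_op_pCons:
  assumes T: "T \<in> bounded_operators"
  shows "poly_op (pCons a p) T x = a *\<^sub>C x + T (poly_op p T x)"
proof -
  have "T (sum f I) = (\<Sum>i\<in>I. T (f i))" for f :: "nat \<Rightarrow> 'a" and I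
    by (induction I rule: infinite_finite_induct)
       (simp_all add: bounded_operators_zero[OF T] bounded_operators_add[OF T])
  moreover have "poly_op (pCons a p) T x = (\<Sum>i\<le>Suc (degree p). coeff (pCons a p) i *\<^sub>C (T ^^ i) x)"
    by (rule poly_op_degree_le) (simp add: degree_pCons_le)
  ultimately show ?thesis
    unfolding sum.atMost_Suc_shift by (simp add: poly_op_def bounded_operators_scaleC[OF T])
qed

lemma poly_op_bounded:
  assumes T: "T \<in> bounded_operators"
  shows "poly_op p T \<in> bounded_operators"
proof (induction p)
  case 0
  then show ?case
    using bounded_operators_scale[of 0] by simp
next
  case (pCons a p)
  have "poly_op (pCons a p) T = (\<lambda>x. a *\<^sub>C x + (T \<circ> poly_op p T) x)"
    by (simp add: fun_eq_iff poly_op_pCons[OF T])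
  then show ?case
    using pCons T by (metis bounded_operators_plus bounded_operators_scale bounded_operators_comp)
qed

lemma poly_op_mult:
  assumes T: "T \<in> bounded_operators"
  shows "poly_op (p * q) T = poly_op p T \<circ> poly_op q T"
  by (induction p)
     (simp_all add: fun_eq_iff poly_op_add poly_op_smult poly_op_pCons[OF T])

lemma poly_op_root_factor:
  assumes T: "T \<in> bounded_operators"
  shows "poly_op [:- z, 1:] T = (\<lambda>x. T x - z *\<^sub>C x)"
  by (simp add: fun_eq_iff poly_op_pCons[OF T] bounded_operators_zero[OF T])

lemma poly_op_diff_const:
  assumes T: "T \<in> bounded_operators"
  shows "poly_op (p - [:c:]) T = (\<lambda>x. poly_op p T x - c *\<^sub>C x)"
  using poly_op_add[of p "[:- c:]" T]
  by (simp add: diff_conv_add_uminus[of p] fun_eq_iff poly_op_pCons[OF T] bounded_operators_zero[OF T]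
      del: add_uminus_conv_diff)

text \<open>The polynomial p - p(z) is divisible by X - z. The two factors give commuting operators,
  so an inverse of p(T) - p(z) would yield one of T - z. Constant \<open>p\<close> is
  included.\<close>

lemma poly_spectrum_subset:
  assumes T: "T \<in> bounded_operators"
  shows "poly p ` spectrum T \<subseteq> spectrum (poly_op p T)"
proof (rule image_subsetI, rule ccontr)
  fix z assume z: "z \<in> spectrum T" and "poly p z \<notin> spectrum (poly_op p T)"
  then have inv: "invertible_operator (poly_op (p - [:poly p z:]) T)"
    by (simp add: spectrum_iff poly_op_diff_const[OF T])
  have "poly (p - [:poly p z:]) z = 0"
    by simp
  then obtain q where q: "p - [:poly p z:] = [:- z, 1:] * q"
    unfolding poly_eq_0_iff_dvd by (elim dvdE)
  define R where "R = poly_op [:- z, 1:] T"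
  have "invertible_operator (R \<circ> poly_op q T)"
    using inv unfolding q poly_op_mult[OF T] R_def .
  moreover have "R \<circ> poly_op q T = poly_op q T \<circ> R"
    unfolding R_def poly_op_mult[OF T, symmetric] by (simp only: mult.commute)
  ultimately have "invertible_operator R"
    unfolding R_def using invertible_operator_cancel_left poly_op_bounded[OF T] by metis
  then show False
    using z unfolding R_def poly_op_root_factor[OF T] by (simp add: spectrum_iff)
qed

text \<open>By the fundamental theorem of algebra \<open>r\<close> splits into linear factors. Their
  roots lie off the spectrum, so every factor is an invertible operator; the induction removes one
  root at a time.\<close>

lemma invertible_poly_op:
  assumes T: "T \<in> bounded_operators"
  shows "r \<noteq> 0 \<Longrightarrow> \<forall>z\<in>spectrum T. poly r z \<noteq> 0 \<Longrightarrow> invertible_operator (poly_op r T)"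
proof (induction "degree r" arbitrary: r)
  case 0
  then obtain c where r: "r = [:c:]" "c \<noteq> 0"
    by (metis degree_eq_zeroE pCons_0_0)
  have "poly_op r T = (\<lambda>x. c *\<^sub>C x)"
    by (simp add: r fun_eq_iff poly_op_pCons[OF T] bounded_operators_zero[OF T])
  then show ?case
    using invertible_operator_scale[OF r(2)] by metis
next
  case (Suc n)
  then have "\<not> constant (poly r)"
    by (simp add: constant_degree)
  then obtain z where z: "poly r z = 0"
    using Fundamental_Theorem_Algebra.fundamental_theorem_of_algebra by blast
  then obtain q where q: "r = [:- z, 1:] * q"
    unfolding poly_eq_0_iff_dvd by (elim dvdE)
  have "q \<noteq> 0"
    using q Suc by auto
  then have "degree r = Suc (degree q)"
    unfolding q by (subst degree_mult_eq) auto
  moreover have "\<forall>z\<in>spectrum T. poly q z \<noteq> 0"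
    using Suc.prems(2) by (simp add: q)
  ultimately have "invertible_operator (poly_op q T)"
    using Suc \<open>q \<noteq> 0\<close> by simp
  moreover have "invertible_operator (poly_op [:- z, 1:] T)"
    using z Suc.prems(2) unfolding poly_op_root_factor[OF T] by (auto simp: spectrum_iff)
  ultimately show ?case
    unfolding q poly_op_mult[OF T] by (intro invertible_operator_comp)
qed

text \<open>If \<open>w\<close> is not a value of \<open>p\<close> on the spectrum, then p - w has
  no zero there; positive degree ensures that p - w is not the zero polynomial.\<close>

lemma spectrum_poly_op_subset:
  assumes T: "T \<in> bounded_operators" and "degree p > 0"
  shows "spectrum (poly_op p T) \<subseteq> poly p ` spectrum T"
proof (rule subsetI, rule ccontr)
  fix w assume w: "w \<in> spectrum (poly_op p T)" "w \<notin> poly p ` spectrum T"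
  have "p - [:w:] \<noteq> 0"
    using assms(2) by auto
  moreover have "\<forall>z\<in>spectrum T. poly (p - [:w:]) z \<noteq> 0"
    using w(2) by auto
  ultimately have "invertible_operator (poly_op (p - [:w:]) T)"
    using invertible_poly_op[OF T] by blast
  then show False
    using w(1) by (simp add: spectrum_iff poly_op_diff_const[OF T])
qed

subsection \<open>Uniform approximation by polynomials\<close>

text \<open>For compact \<open>X\<close> this is membership in the uniform algebra usually written
  P(X); only the values of \<open>f\<close> on \<open>X\<close> matter.\<close>

definition poly_approximable :: "complex set \<Rightarrow> (complex \<Rightarrow> complex) \<Rightarrow> bool" where
  "poly_approximable X f \<longleftrightarrow> (\<forall>e>0. \<exists>p. \<forall>z\<in>X. cmod (poly p z - f z) < e)"

lemma poly_approximableD: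
  assumes "poly_approximable X f" "e > 0"
  obtains p where "\<And>z. z \<in> X \<Longrightarrow> cmod (poly p z - f z) < e"
  using assms unfolding poly_approximable_def by blast

lemma poly_approximable_poly: "poly_approximable X (poly p)"
  unfolding poly_approximable_def by (auto intro!: exI[of _ p])

lemma poly_approximable_cong:
  assumes "poly_approximable X f" "\<And>z. z \<in> X \<Longrightarrow> f z = g z"
  shows "poly_approximable X g"
  using assms by (simp add: poly_approximable_def)

lemma poly_approximable_const: "poly_approximable X (\<lambda>z. c)"
  by (rule poly_approximable_cong[OF poly_approximable_poly[of X "[:c:]"]]) simp

lemma poly_approximable_limit:
  assumes "\<And>e. e > 0 \<Longrightarrow> \<exists>g. poly_approximable X g \<and> (\<forall>z\<in>X. cmod (g z - f z) \<le> e)"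
  shows "poly_approximable X f"
  unfolding poly_approximable_def
proof (intro allI impI)
  fix e :: real assume "e > 0"
  then obtain g where g: "poly_approximable X g" "\<And>z. z \<in> X \<Longrightarrow> cmod (g z - f z) \<le> e / 2"
    using assms[of "e / 2"] by auto
  obtain p where p: "\<And>z. z \<in> X \<Longrightarrow> cmod (poly p z - g z) < e / 2"
    using poly_approximableD[OF g(1), of "e / 2"] \<open>e > 0\<close> by auto
  have "cmod (poly p z - f z) < e" if "z \<in> X" for z
    using norm_triangle_ineq[of "poly p z - g z" "g z - f z"] p[OF that] g(2)[OF that] by simp
  then show "\<exists>p. \<forall>z\<in>X. cmod (poly p z - f z) < e"
    by blast
qed

lemma poly_approximable_add:
  assumes "poly_approximable X f" "poly_approximable X g"
  shows "poly_approximable X (\<lambda>z. f z + g z)"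
  unfolding poly_approximable_def
proof (intro allI impI)
  fix e :: real assume "e > 0"
  then obtain p q where p: "\<And>z. z \<in> X \<Longrightarrow> cmod (poly p z - f z) < e / 2"
      and q: "\<And>z. z \<in> X \<Longrightarrow> cmod (poly q z - g z) < e / 2"
    using assms by (metis half_gt_zero poly_approximableD)
  have "cmod (poly (p + q) z - (f z + g z)) < e" if "z \<in> X" for z
    using norm_triangle_ineq[of "poly p z - f z" "poly q z - g z"] p[OF that] q[OF that]
    by (simp add: algebra_simps)
  then show "\<exists>p. \<forall>z\<in>X. cmod (poly p z - (f z + g z)) < e"
    by blast
qed

lemma poly_approximable_sum:
  "(\<And>i. i \<in> I \<Longrightarrow> poly_approximable X (f i)) \<Longrightarrow> poly_approximable X (\<lambda>z. \<Sum>i\<in>I. f i z)"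
  by (induction I rule: infinite_finite_induct)
     (auto intro: poly_approximable_const poly_approximable_add)

text \<open>One factor is replaced at a time, first \<open>g\<close> against a fixed polynomial and
  then \<open>f\<close> against \<open>g\<close>; each error is scaled by a bound of the other
  factor.\<close>

lemma poly_approximable_mult:
  assumes f: "poly_approximable X f" and g: "poly_approximable X g" and X: "compact X"
  shows "poly_approximable X (\<lambda>z. f z * g z)"
proof -
  \<comment> \<open>Such a function stays within 1 of a polynomial, which is bounded on the compact
    set \<open>X\<close>.\<close>
  have bdd: "\<exists>B>0. \<forall>z\<in>X. cmod (h z) \<le> B" if h: "poly_approximable X h" for h
  proof -
    obtain p where p: "\<And>z. z \<in> X \<Longrightarrow> cmod (poly p z - h z) < 1"
      using poly_approximableD[OF h, of 1] by auto
    have "compact (poly p ` X)"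
      by (intro compact_continuous_image continuous_intros X)
    then obtain B where B: "B > 0" "\<And>z. z \<in> X \<Longrightarrow> cmod (poly p z) \<le> B"
      by (auto dest!: compact_imp_bounded simp: bounded_pos)
    have "cmod (h z) \<le> B + 1" if "z \<in> X" for z
      using norm_triangle_ineq2[of "h z" "poly p z"] p[OF that] B(2)[OF that]
      by (simp add: norm_minus_commute)
    then show ?thesis
      using B(1) by (intro exI[of _ "B + 1"]) auto
  qed
  obtain B where B: "B > 0" "\<And>z. z \<in> X \<Longrightarrow> cmod (g z) \<le> B"
    using bdd[OF g] by auto
  have left: "poly_approximable X (\<lambda>z. poly p z * g z)" for p
  proof (rule poly_approximable_limit)
    fix e :: real assume "e > 0"
    obtain C where C: "C > 0" "\<And>z. z \<in> X \<Longrightarrow> cmod (poly p z) \<le> C"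
      using bdd[OF poly_approximable_poly] by blast
    obtain q where q: "\<And>z. z \<in> X \<Longrightarrow> cmod (poly q z - g z) < e / C"
      using poly_approximableD[OF g, of "e / C"] \<open>e > 0\<close> C(1) by auto
    have "cmod (poly (p * q) z - poly p z * g z) \<le> e" if "z \<in> X" for z
    proof -
      have "cmod (poly (p * q) z - poly p z * g z) = cmod (poly p z) * cmod (poly q z - g z)"
        by (simp add: algebra_simps flip: norm_mult)
      also have "\<dots> \<le> C * (e / C)"
        using q[OF that] C that by (intro mult_mono) auto
      finally show ?thesis using C(1) by simp
    qed
    then show "\<exists>h. poly_approximable X h \<and> (\<forall>z\<in>X. cmod (h z - poly p z * g z) \<le> e)"
      using poly_approximable_poly by blast
  qed
  show ?thesis
  proof (rule poly_approximable_limit)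
    fix e :: real assume "e > 0"
    obtain p where p: "\<And>z. z \<in> X \<Longrightarrow> cmod (poly p z - f z) < e / B"
      using poly_approximableD[OF f, of "e / B"] \<open>e > 0\<close> B(1) by auto
    have "cmod (poly p z * g z - f z * g z) \<le> e" if "z \<in> X" for z
    proof -
      have "cmod (poly p z * g z - f z * g z) = cmod (poly p z - f z) * cmod (g z)"
        by (simp add: algebra_simps flip: norm_mult)
      also have "\<dots> \<le> (e / B) * B"
        using p[OF that] B that \<open>e > 0\<close> by (intro mult_mono) auto
      finally show ?thesis using B(1) by simp
    qed
    then show "\<exists>h. poly_approximable X h \<and> (\<forall>z\<in>X. cmod (h z - f z * g z) \<le> e)"
      using left by (intro exI[of _ "\<lambda>z. poly p z * g z"]) auto
  qed
qed

lemma poly_approximable_power: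
  "poly_approximable X f \<Longrightarrow> compact X \<Longrightarrow> poly_approximable X (\<lambda>z. f z ^ n)"
  by (induction n) (auto intro: poly_approximable_const poly_approximable_mult)

section \<open>Geometric series and pole pushing\<close>

lemma poly_approximable_geometric:
  assumes f: "poly_approximable X f" and X: "compact X"
    and small: "\<And>z. z \<in> X \<Longrightarrow> cmod (f z) \<le> 1 / 2"
  shows "poly_approximable X (\<lambda>z. 1 / (1 - f z))"
proof (rule poly_approximable_limit)
  fix e :: real assume "e > 0"
  \<comment> \<open>The tail of the geometric series after \<open>n\<close> terms is at most
    \<open>(1 / 2) ^ n / (1 / 2)\<close>, which explains the bound \<open>e / 2\<close>.\<close>
  then obtain n where n: "(1 / 2 :: real) ^ n < e / 2"
    using real_arch_pow_inv[of "e / 2" "1 / 2"] by auto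
  have "cmod ((\<Sum>k<n. f z ^ k) - 1 / (1 - f z)) \<le> e" if "z \<in> X" for z
  proof -
    have ne: "1 - f z \<noteq> 0"
      using small[OF that] by auto
    have ge: "1 / 2 \<le> cmod (1 - f z)"
      using norm_triangle_ineq2[of 1 "f z"] small[OF that] by simp
    have "(\<Sum>k<n. f z ^ k) - 1 / (1 - f z) = - (f z ^ n) / (1 - f z)"
      using ne one_diff_power_eq[of "f z" n] by (simp add: field_simps)
    then have "cmod ((\<Sum>k<n. f z ^ k) - 1 / (1 - f z)) = cmod (f z) ^ n / cmod (1 - f z)"
      by (simp add: norm_divide norm_power)
    also have "\<dots> \<le> (1 / 2) ^ n / (1 / 2)"
      using ge small[OF that] by (intro frac_le power_mono) auto
    finally show ?thesis using n by simp
  qed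
  moreover have "poly_approximable X (\<lambda>z. \<Sum>k<n. f z ^ k)"
    by (intro poly_approximable_sum poly_approximable_power f X)
  ultimately show "\<exists>g. poly_approximable X g \<and> (\<forall>z\<in>X. cmod (g z - 1 / (1 - f z)) \<le> e)"
    by blast
qed

text \<open>Expand 1/(z - b) around the old pole: it equals 1/(z - a) times 1/(1 - (b - a)/(z - a)),
  a geometric series whose ratio has modulus at most 1/2 on \<open>X\<close>.\<close>

lemma poly_approximable_move_pole:
  assumes a: "poly_approximable X (\<lambda>z. 1 / (z - a))" and X: "compact X"
    and d: "d > 0" "\<And>z. z \<in> X \<Longrightarrow> d \<le> cmod (z - a)" and b: "cmod (b - a) \<le> d / 2"
  shows "poly_approximable X (\<lambda>z. 1 / (z - b))"
proof -
  have *: "poly_approximable X (\<lambda>z. (b - a) * (1 / (z - a)))"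
    by (intro poly_approximable_mult poly_approximable_const a X)
  have "poly_approximable X (\<lambda>z. (1 / (z - a)) * (1 / (1 - (b - a) * (1 / (z - a)))))"
  proof (intro poly_approximable_mult[OF a poly_approximable_geometric[OF *]] X)
    fix z assume "z \<in> X"
    have "cmod (b - a) / cmod (z - a) \<le> (d / 2) / d"
      using b d \<open>z \<in> X\<close> by (intro frac_le) auto
    then show "cmod ((b - a) * (1 / (z - a))) \<le> 1 / 2"
      using d(1) by (simp add: norm_divide)
  qed
  then show ?thesis
  proof (rule poly_approximable_cong)
    fix z assume "z \<in> X"
    then have "z \<noteq> a" using d by force
    then show "(1 / (z - a)) * (1 / (1 - (b - a) * (1 / (z - a)))) = 1 / (z - b)"
      by (simp add: field_simps)
  qed
qed

text \<open>Approximability holds for a pole far away, where it comes from a geometric series in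
  z/a. It passes between nearby poles, and connectedness of the complement carries it to
  \<open>b\<close>.\<close>

lemma poly_approximable_inverse:
  assumes X: "compact X" and conn: "connected (- X)" and b: "b \<notin> X"
  shows "poly_approximable X (\<lambda>z. 1 / (z - b))"
proof -
  obtain R where R: "R > 0" "\<And>z. z \<in> X \<Longrightarrow> cmod z \<le> R"
    using compact_imp_bounded[OF X] by (auto simp: bounded_pos)
  \<comment> \<open>At modulus \<open>2 * R\<close> the ratio z/a is at most 1/2 in modulus on
    \<open>X\<close>.\<close>
  define a where "a = complex_of_real (2 * R)"
  have aX: "a \<in> - X"
    using R by (force simp: a_def)
  have *: "poly_approximable X (\<lambda>z. z / a)"
    by (rule poly_approximable_cong[OF poly_approximable_poly[of X "[:0, 1 / a:]"]]) simp
  have "poly_approximable X (\<lambda>z. (- 1 / a) * (1 / (1 - z / a)))"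
    using R by (intro poly_approximable_mult poly_approximable_const poly_approximable_geometric X *)
      (simp add: a_def norm_divide field_simps)
  then have a: "poly_approximable X (\<lambda>z. 1 / (z - a))"
  proof (rule poly_approximable_cong)
    fix z assume "z \<in> X"
    then have "z \<noteq> a" using aX by auto
    moreover have "a \<noteq> 0" using R(1) by (simp add: a_def)
    ultimately show "(- 1 / a) * (1 / (1 - z / a)) = 1 / (z - a)"
      by (simp add: divide_simps)
  qed
  show ?thesis
  proof (rule connected_induction_simple[where P = "\<lambda>b. poly_approximable X (\<lambda>z. 1 / (z - b))",
        OF conn aX _ a])
    show "b \<in> - X" using b by simp
  next
    fix c assume "c \<in> - X"
    then obtain d where d: "d > 0" "ball c d \<subseteq> - X"
      using compact_imp_closed[OF X] by (metis openE open_Compl)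
    \<comment> \<open>With radius \<open>d / 5\<close>, each point of the ball is at distance at
      least \<open>4 * d / 5\<close> from \<open>X\<close>, and two points of it differ by at most
      half of that.\<close>
    have P: "poly_approximable X (\<lambda>z. 1 / (z - y))"
      if "x \<in> ball c (d / 5)" "y \<in> ball c (d / 5)" "poly_approximable X (\<lambda>z. 1 / (z - x))" for x y
    proof (rule poly_approximable_move_pole[OF that(3) X, of "4 * d / 5"])
      fix z assume "z \<in> X"
      then have "dist c z \<ge> d"
        using d(2) by (meson ComplD mem_ball not_le subsetD)
      then show "4 * d / 5 \<le> cmod (z - x)"
        using that(1) dist_triangle[of c z x] by (simp add: dist_norm norm_minus_commute)
    next
      show "cmod (y - x) \<le> 4 * d / 5 / 2"
        using that(1,2) dist_triangle[of y x c] by (simp add: dist_norm norm_minus_commute)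
    qed (use d in auto)
    have "ball c (d / 5) \<subseteq> - X"
      using d subset_ball[of "d / 5" d c] by force
    then have "openin (top_of_set (- X)) (ball c (d / 5))"
      by (simp add: open_subset)
    then show "\<exists>T. openin (top_of_set (- X)) T \<and> c \<in> T \<and>
        (\<forall>x\<in>T. \<forall>y\<in>T. poly_approximable X (\<lambda>z. 1 / (z - x)) \<longrightarrow> poly_approximable X (\<lambda>z. 1 / (z - y)))"
      using P centre_in_ball[of c "d / 5"] d(1) by (metis divide_pos_pos zero_less_numeral)
  qed
qed

section \<open>Parameter integrals and indicators of simply connected sets\<close>

lemma poly_approximable_integral:
  fixes h :: "real \<Rightarrow> complex \<Rightarrow> complex"
  assumes X: "compact X" and cont: "continuous_on ({0..1} \<times> X) (\<lambda>(t, z). h t z)"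
    and h: "\<And>t. t \<in> {0..1} \<Longrightarrow> poly_approximable X (h t)"
  shows "poly_approximable X (\<lambda>z. integral {0..1} (\<lambda>t. h t z))"
proof (rule poly_approximable_limit)
  fix e :: real assume "e > 0"
  have ct: "continuous_on {0..1} (\<lambda>t. h t z)" if "z \<in> X" for z
    by (rule continuous_on_compose2[OF cont, of "{0..1}" "\<lambda>t. (t, z)", simplified])
       (use that in \<open>auto intro!: continuous_intros\<close>)
  have int: "(\<lambda>t. h t z) integrable_on {a..b}" if "z \<in> X" "0 \<le> a" "b \<le> 1" for z a b
    by (rule integrable_continuous_real, rule continuous_on_subset[OF ct]) (use that in auto)
  have unif: "uniformly_continuous_on ({0..1} \<times> X) (\<lambda>(t, z). h t z)"
    by (intro compact_uniformly_continuous cont compact_Times X compact_Icc)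
  \<comment> \<open>An error allowance proportional to the length adds up when intervals are joined,
    so Bolzano's bisection principle reduces \<open>P 0 1\<close> to short intervals. There
    \<open>b - a\<close> times a polynomial close to \<open>h x\<close> approximates the
    integral.\<close>
  define P where "P a b \<longleftrightarrow> (0 \<le> a \<longrightarrow> a \<le> b \<longrightarrow> b \<le> 1 \<longrightarrow>
    (\<exists>p. \<forall>z\<in>X. cmod (poly p z - integral {a..b} (\<lambda>t. h t z)) \<le> e * (b - a)))" for a b
  have "P 0 1"
  proof (rule Bolzano)
    fix a b c assume trans: "P a b" "P b c" "a \<le> b" "b \<le> c"
    show "P a c"
      unfolding P_def
    proof (intro impI)
      assume ac: "0 \<le> a" "a \<le> c" "c \<le> 1"
      then obtain p q where p: "\<And>z. z \<in> X \<Longrightarrow> cmod (poly p z - integral {a..b} (\<lambda>t. h t z)) \<le> e * (b - a)"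
          and q: "\<And>z. z \<in> X \<Longrightarrow> cmod (poly q z - integral {b..c} (\<lambda>t. h t z)) \<le> e * (c - b)"
        using trans unfolding P_def by (meson order_trans)
      have "cmod (poly (p + q) z - integral {a..c} (\<lambda>t. h t z)) \<le> e * (c - a)" if "z \<in> X" for z
      proof -
        have "integral {a..c} (\<lambda>t. h t z) = integral {a..b} (\<lambda>t. h t z) + integral {b..c} (\<lambda>t. h t z)"
          using Henstock_Kurzweil_Integration.integral_combine[OF trans(3,4) int[OF that ac(1,3)]] by simp
        then show ?thesis
          using norm_triangle_ineq[of "poly p z - integral {a..b} (\<lambda>t. h t z)"
              "poly q z - integral {b..c} (\<lambda>t. h t z)"]
            p[OF that] q[OF that] by (simp add: algebra_simps)
      qed
      then show "\<exists>p. \<forall>z\<in>X. cmod (poly p z - integral {a..c} (\<lambda>t. h t z)) \<le> e * (c - a)"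
        by blast
    qed
  next
    fix x :: real assume local: "0 \<le> x" "x \<le> 1"
    \<comment> \<open>Uniform continuity on the compact product makes \<open>d\<close> independent
      of \<open>z\<close>.\<close>
    obtain d where d: "d > 0" "\<And>t t' z. t \<in> {0..1} \<Longrightarrow> t' \<in> {0..1} \<Longrightarrow> z \<in> X \<Longrightarrow> \<bar>t - t'\<bar> < d \<Longrightarrow>
        cmod (h t z - h t' z) < e / 2"
    proof -
      obtain d where "d > 0" and d: "\<And>u v. u \<in> {0..1} \<times> X \<Longrightarrow> v \<in> {0..1} \<times> X \<Longrightarrow> dist v u < d \<Longrightarrow>
          dist (case v of (t, z) \<Rightarrow> h t z) (case u of (t, z) \<Rightarrow> h t z) < e / 2"
        using unif \<open>e > 0\<close> unfolding uniformly_continuous_on_def by (meson half_gt_zero)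
      show thesis
      proof (rule that[OF \<open>d > 0\<close>])
        fix t t' z assume "t \<in> {0..1}" "t' \<in> {0..1}" "z \<in> X" "\<bar>t - t'\<bar> < d"
        then show "cmod (h t z - h t' z) < e / 2"
          using d[of "(t', z)" "(t, z)"] by (simp add: dist_Pair_Pair dist_norm)
      qed
    qed
    obtain p where p: "\<And>z. z \<in> X \<Longrightarrow> cmod (poly p z - h x z) < e / 2"
      using poly_approximableD[OF h[of x], of "e / 2"] local \<open>e > 0\<close> by auto
    have "P a b" if ab: "a \<le> x" "x \<le> b" "b - a < d" for a b
      unfolding P_def
    proof (intro impI exI ballI)
      fix z assume z: "z \<in> X" and "0 \<le> a" "a \<le> b" "b \<le> 1"
      have "cmod (integral {a..b} (\<lambda>t. poly p z - h t z)) \<le> e * (b - a)"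
      proof (rule integral_bound)
        show "continuous_on {a..b} (\<lambda>t. poly p z - h t z)"
          by (intro continuous_intros continuous_on_subset[OF ct[OF z]]) (use \<open>0 \<le> a\<close> \<open>b \<le> 1\<close> in auto)
        fix t assume t: "t \<in> {a..b}"
        have "cmod (h x z - h t z) < e / 2"
          by (rule d(2)) (use t ab z \<open>0 \<le> a\<close> \<open>b \<le> 1\<close> in auto)
        then show "cmod (poly p z - h t z) \<le> e"
          using p[OF z] norm_triangle_ineq[of "poly p z - h x z" "h x z - h t z"] by simp
      qed fact
      moreover have "integral {a..b} (\<lambda>t. poly p z - h t z)
          = (b - a) *\<^sub>R poly p z - integral {a..b} (\<lambda>t. h t z)"
        using int[OF z \<open>0 \<le> a\<close> \<open>b \<le> 1\<close>] \<open>a \<le> b\<close> by (subst integral_diff) auto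
      ultimately show "cmod (poly (smult (of_real (b - a)) p) z - integral {a..b} (\<lambda>t. h t z)) \<le> e * (b - a)"
        by (simp add: scaleR_conv_of_real)
    qed
    with d(1) show "\<exists>d>0. \<forall>a b. a \<le> x \<and> x \<le> b \<and> b - a < d \<longrightarrow> P a b"
      by blast
  qed auto
  then show "\<exists>g. poly_approximable X g \<and> (\<forall>z\<in>X. cmod (g z - integral {0..1} (\<lambda>t. h t z)) \<le> e)"
    unfolding P_def using poly_approximable_poly by force
qed

text \<open>Let \<open>g\<close> be the inverse of a Riemann map \<open>f\<close> of
  \<open>V\<close>. By the argument principle, the integral of g'/(g - z) over the circle of radius
  \<open>r\<close>, divided by 2 pi i, counts the solutions of g = z inside it: one for
  \<open>z\<close> in \<open>X \<inter> V\<close>, none for \<open>z\<close> outside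
  \<open>V\<close>. Since \<open>X \<inter> V\<close> is compact, \<open>r\<close> can be chosen so
  that the image of the circle under \<open>g\<close> avoids \<open>X\<close>; for each point of the
  circle the integrand, as a function of \<open>z\<close>, then has its only possible pole off
  \<open>X\<close>.\<close>

lemma poly_approximable_indicator_simply_connected:
  assumes V: "open V" "simply_connected V" "V \<noteq> UNIV"
    and X: "compact X" "connected (- X)" and XV: "compact (X \<inter> V)"
  shows "poly_approximable X (\<lambda>z. if z \<in> V then 1 else 0)"
proof (cases "V = {}")
  case True
  then show ?thesis by (simp add: poly_approximable_const)
next
  case False
  then obtain f g where f: "f holomorphic_on V" and g: "g holomorphic_on ball 0 1"
      and fg: "\<And>z. z \<in> V \<Longrightarrow> f z \<in> ball 0 1 \<and> g (f z) = z"
      and gf: "\<And>z. z \<in> ball 0 1 \<Longrightarrow> g z \<in> V \<and> f (g z) = z"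
    using V Riemann_mapping_theorem[of V] by metis
  obtain r where r: "0 < r" "r < 1" and fr: "\<And>z. z \<in> X \<inter> V \<Longrightarrow> cmod (f z) < r"
  proof -
    obtain s where s: "\<And>z. z \<in> X \<inter> V \<Longrightarrow> cmod (f z) \<le> s" "s < 1"
    proof (cases "X \<inter> V = {}")
      case True
      show thesis by (rule that[of 0]) (use True in auto)
    next
      case False
      have "continuous_on (X \<inter> V) (\<lambda>z. cmod (f z))"
        by (intro continuous_intros holomorphic_on_imp_continuous_on holomorphic_on_subset[OF f]) auto
      then obtain w where "w \<in> X \<inter> V" "\<And>z. z \<in> X \<inter> V \<Longrightarrow> cmod (f z) \<le> cmod (f w)"
        using continuous_attains_sup[OF XV False] by blast
      then show thesis
        using fg by (intro that[of "cmod (f w)"]) auto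
    qed
    show thesis
      \<comment> \<open>The midpoint between 1 and \<open>max s 0\<close> is positive even if
        \<open>s\<close> is negative, which can happen when \<open>X \<inter> V\<close> is
        empty.\<close>
      by (rule that[of "(1 + max s 0) / 2"]) (use s in \<open>fastforce+\<close>)
  qed
  define \<gamma> where "\<gamma> = circlepath 0 r"
  have \<gamma>: "\<gamma> t \<in> ball 0 1" "cmod (\<gamma> t) = r" if "t \<in> {0..1}" for t
  proof -
    have "\<gamma> t \<in> path_image \<gamma>"
      using that by (simp add: path_image_def)
    then show "\<gamma> t \<in> ball 0 1" "cmod (\<gamma> t) = r"
      using r by (auto simp: \<gamma>_def)
  qed
  have gX: "g \<xi> \<notin> X" if "\<xi> \<in> ball 0 1" "cmod \<xi> = r" for \<xi>
    using gf[OF that(1)] fr[of "g \<xi>"] that(2) by auto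
  have g': "deriv g holomorphic_on ball 0 1"
    by (intro holomorphic_deriv g open_ball)
  \<comment> \<open>This is the integrand pulled back to \<open>{0..1}\<close> and divided by 2 pi
    i: the last factor is the derivative of the circle path with 2 pi i cancelled.\<close>
  define h where "h t z = deriv g (\<gamma> t) / (g (\<gamma> t) - z) * (r * exp (2 * of_real pi * \<i> * of_real t))" for t z
  have "poly_approximable X (\<lambda>z. integral {0..1} (\<lambda>t. h t z))"
  proof (rule poly_approximable_integral[OF X(1)])
    have cont\<gamma>: "continuous_on ({0..1} \<times> X) (\<lambda>x. \<gamma> (fst x))"
      by (rule continuous_on_compose2[of "{0..1}" \<gamma>])
         (auto intro!: continuous_intros simp: \<gamma>_def simp flip: path_def)
    have "continuous_on ({0..1} \<times> X) (\<lambda>x. g (\<gamma> (fst x)))"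
        "continuous_on ({0..1} \<times> X) (\<lambda>x. deriv g (\<gamma> (fst x)))"
      using \<gamma> by (auto intro!: continuous_on_compose2[OF holomorphic_on_imp_continuous_on[OF g] cont\<gamma>]
          continuous_on_compose2[OF holomorphic_on_imp_continuous_on[OF g'] cont\<gamma>])
    then show "continuous_on ({0..1} \<times> X) (\<lambda>(t, z). h t z)"
      unfolding h_def case_prod_beta
      by (intro continuous_intros) (use \<gamma> gX in \<open>force+\<close>)
  next
    fix t :: real assume t: "t \<in> {0..1}"
    have "poly_approximable X (\<lambda>z. (- deriv g (\<gamma> t) * (r * exp (2 * of_real pi * \<i> * of_real t)))
        * (1 / (z - g (\<gamma> t))))"
      using \<gamma>[OF t] by (intro poly_approximable_mult poly_approximable_const poly_approximable_inverse X gX)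
    then show "poly_approximable X (h t)"
    proof (rule poly_approximable_cong)
      fix z assume "z \<in> X"
      then have "g (\<gamma> t) \<noteq> z" using gX[OF \<gamma>[OF t]] by auto
      then show "- deriv g (\<gamma> t) * (r * exp (2 * of_real pi * \<i> * of_real t)) * (1 / (z - g (\<gamma> t))) = h t z"
        by (simp add: h_def divide_simps) (simp add: algebra_simps)
    qed
  qed
  then show ?thesis
  proof (rule poly_approximable_cong)
    fix z assume z: "z \<in> X"
    have int: "integral {0..1} (\<lambda>t. h t z) = I / (2 * pi * \<i>)"
      if "((\<lambda>\<xi>. deriv g \<xi> / (g \<xi> - z)) has_contour_integral I) \<gamma>" for I
    proof -
      have "((\<lambda>t. (deriv g (\<gamma> t) / (g (\<gamma> t) - z) * vector_derivative \<gamma> (at t within {0..1})) / (2 * pi * \<i>))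
          has_integral I / (2 * pi * \<i>)) {0..1}"
        using that unfolding has_contour_integral_def by (rule has_integral_divide)
      then have "((\<lambda>t. h t z) has_integral I / (2 * pi * \<i>)) {0..1}"
        by (rule has_integral_eq[rotated]) (simp add: h_def \<gamma>_def vector_derivative_circlepath01)
      then show ?thesis by (rule integral_unique)
    qed
    show "integral {0..1} (\<lambda>t. h t z) = (if z \<in> V then 1 else 0)"
    proof (cases "z \<in> V")
      case False
      \<comment> \<open>All values of \<open>g\<close> on the disc lie in \<open>V\<close>, so the
        denominator never vanishes there and Cauchy's theorem applies.\<close>
      have "((\<lambda>\<xi>. deriv g \<xi> / (g \<xi> - z)) has_contour_integral 0) \<gamma>"
        using gf False r
        by (intro Cauchy_theorem_disc_simple[of _ 0 1] holomorphic_intros g g') (auto simp: \<gamma>_def)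
      with False show ?thesis by (simp add: int)
    next
      case True
      define u where "u = f z"
      have u: "u \<in> ball 0 1" "g u = z" "cmod u < r"
        using True z fg fr by (auto simp: u_def)
      \<comment> \<open>The difference quotient of \<open>g\<close> at \<open>u\<close>, with its
        removable singularity filled in. It has no zero, because \<open>g\<close> is injective and
        \<open>deriv g u\<close> is nonzero. Writing g'/(g - z) as (g'/F)/(\<xi> - u) lets Cauchy's
        formula evaluate the integral, and g'/F equals 1 at \<open>u\<close>.\<close>
      define F where "F \<xi> = (if \<xi> = u then deriv g u else (g \<xi> - g u) / (\<xi> - u))" for \<xi>
      have F: "F holomorphic_on ball 0 1"
        unfolding F_def by (rule pole_lemma_open[OF g open_ball])
      \<comment> \<open>The chain rule for f(g(\<xi>)) = \<xi> would otherwise give derivative 0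
        instead of 1.\<close>
      have g'u: "deriv g u \<noteq> 0"
      proof
        assume 0: "deriv g u = 0"
        have "(g has_field_derivative 0) (at u)"
          using holomorphic_derivI[OF g open_ball u(1)] 0 by simp
        moreover have "(f has_field_derivative deriv f z) (at (g u))"
          using holomorphic_derivI[OF f V(1) True] u(2) by simp
        ultimately have "((\<lambda>\<xi>. f (g \<xi>)) has_field_derivative deriv f z * 0) (at u)"
          by (rule DERIV_chain2[rotated])
        moreover have "((\<lambda>\<xi>. f (g \<xi>)) has_field_derivative 1) (at u)"
          by (rule has_field_derivative_transform_within_open[OF DERIV_ident open_ball u(1)])
             (use gf in auto)
        ultimately show False
          using DERIV_unique by fastforce
      qed
      have F0: "F \<xi> \<noteq> 0" if "\<xi> \<in> ball 0 1" for \<xi>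
        using g'u gf[OF that] gf[OF u(1)] by (auto simp: F_def)
      have "(\<lambda>\<xi>. deriv g \<xi> / F \<xi>) holomorphic_on cball 0 r"
        by (rule holomorphic_on_subset[of _ "ball 0 1"]) (use F0 r in \<open>auto intro!: holomorphic_intros g' F\<close>)
      then have "((\<lambda>\<xi>. deriv g \<xi> / F \<xi> / (\<xi> - u)) has_contour_integral
          (2 * of_real pi * \<i> * (deriv g u / F u))) \<gamma>"
        unfolding \<gamma>_def by (rule Cauchy_integral_circlepath_simple) (use u in simp)
      then have "((\<lambda>\<xi>. deriv g \<xi> / (g \<xi> - z)) has_contour_integral (2 * of_real pi * \<i> * (deriv g u / F u))) \<gamma>"
      proof (rule has_contour_integral_eq)
        fix \<xi> assume "\<xi> \<in> path_image \<gamma>"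
        then have "\<xi> \<noteq> u" using u r by (auto simp: \<gamma>_def)
        then show "deriv g \<xi> / F \<xi> / (\<xi> - u) = deriv g \<xi> / (g \<xi> - z)"
          by (simp add: F_def u(2))
      qed
      then show ?thesis
        using True g'u by (simp add: int F_def)
    qed
  qed
qed

text \<open>For a closed path in \<open>V\<close>, the maximum principle bounds every
  \<open>p\<close> in \<open>F\<close> inside the path by its maximum on the path, which is below 1.
  The path together with its inside is connected, hence contained in \<open>V\<close>, so points off
  \<open>V\<close> lie outside the path and have winding number 0.\<close>

lemma simply_connected_component_poly_polyhedron:
  fixes F :: "complex poly set"
  assumes "finite F" and V: "V \<in> components {z. \<forall>p\<in>F. cmod (poly p z) < 1}"
  shows "open V" "simply_connected V"
proof -
  define \<Omega> where "\<Omega> = {z. \<forall>p\<in>F. cmod (poly p z) < 1}"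
  have "\<Omega> = (\<Inter>p\<in>F. {z. cmod (poly p z) < 1})"
    by (auto simp: \<Omega>_def)
  moreover have "open {z. cmod (poly p z) < 1}" for p
    by (intro open_Collect_less continuous_intros)
  ultimately have "open \<Omega>"
    using \<open>finite F\<close> by auto
  have V: "V \<in> components \<Omega>"
    using V by (simp add: \<Omega>_def)
  show "open V"
    using open_components[OF \<open>open \<Omega>\<close> V] .
  have "winding_number \<gamma> z = 0"
    if \<gamma>: "path \<gamma>" "path_image \<gamma> \<subseteq> V" "pathfinish \<gamma> = pathstart \<gamma>" and z: "z \<notin> V" for \<gamma> z
  proof (rule winding_number_zero_in_outside[OF \<gamma>(1,3)])
    have "inside (path_image \<gamma>) \<subseteq> \<Omega>"
    proof
      fix w assume w: "w \<in> inside (path_image \<gamma>)"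
      have "cmod (poly p w) < 1" if "p \<in> F" for p
      proof -
        have "continuous_on (path_image \<gamma>) (\<lambda>z. cmod (poly p z))"
          by (intro continuous_intros)
        then obtain v where v: "v \<in> path_image \<gamma>"
            "\<And>z. z \<in> path_image \<gamma> \<Longrightarrow> cmod (poly p z) \<le> cmod (poly p v)"
          using continuous_attains_sup[OF compact_path_image[OF \<gamma>(1)] path_image_nonempty] by blast
        have "cmod (poly p w) \<le> cmod (poly p v)"
        proof (rule maximum_modulus_frontier[OF _ _ bounded_inside[OF bounded_path_image[OF \<gamma>(1)]] _ w])
          show "cmod (poly p z) \<le> cmod (poly p v)" if "z \<in> frontier (inside (path_image \<gamma>))" for z
            using that v(2) frontier_inside_subset[OF closed_path_image[OF \<gamma>(1)]] by auto
        qed (auto intro!: holomorphic_intros continuous_intros)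
        also have "\<dots> < 1"
          using v(1) \<gamma>(2) in_components_subset[OF V] \<open>p \<in> F\<close> by (auto simp: \<Omega>_def)
        finally show ?thesis .
      qed
      then show "w \<in> \<Omega>" by (simp add: \<Omega>_def)
    qed
    then have "path_image \<gamma> \<union> inside (path_image \<gamma>) \<subseteq> \<Omega>"
      using \<gamma>(2) in_components_subset[OF V] by auto
    moreover have "connected (path_image \<gamma> \<union> inside (path_image \<gamma>))"
      using \<gamma>(1) by (intro connected_with_inside closed_path_image connected_path_image)
    moreover have "V \<inter> (path_image \<gamma> \<union> inside (path_image \<gamma>)) \<noteq> {}"
      using \<gamma>(2) path_image_nonempty[of \<gamma>] by blast
    ultimately have "path_image \<gamma> \<union> inside (path_image \<gamma>) \<subseteq> V"
      using components_maximal[OF V] by blast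
    then show "z \<in> outside (path_image \<gamma>)"
      using z inside_Un_outside[of "path_image \<gamma>"] by blast
  qed
  then show "simply_connected V"
    using in_components_connected[OF V] by (simp add: simply_connected_eq_winding_number_zero[OF \<open>open V\<close>])
qed

subsection \<open>Polynomially convex hulls\<close>

text \<open>A real \<open>SUP\<close> is an upper bound only of a set bounded above; here the
  polynomial is bounded on the compact closure of \<open>S\<close>.\<close>

lemma cmod_poly_le_SUP:
  assumes "bounded S" "w \<in> S"
  shows "cmod (poly p w) \<le> (SUP w\<in>S. cmod (poly p w))"
proof (rule cSUP_upper[OF assms(2)])
  have "compact ((\<lambda>w. cmod (poly p w)) ` closure S)"
    by (intro compact_continuous_image continuous_intros) (use assms in \<open>simp add: compact_closure\<close>)
  then show "bdd_above ((\<lambda>w. cmod (poly p w)) ` S)"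
    using closure_subset by (meson bdd_above_mono bounded_imp_bdd_above compact_imp_bounded image_mono)
qed

lemma subset_polynomial_hull: "bounded S \<Longrightarrow> S \<subseteq> polynomial_hull S"
  by (auto simp: polynomial_hull_def intro: cmod_poly_le_SUP)

lemma polynomial_hull_empty: "polynomial_hull {} = {}"
proof -
  have "\<exists>p. \<not> cmod (poly p z) \<le> (SUP w\<in>{}. cmod (poly p w))" for z
    by (rule exI[of _ "[:of_real (\<bar>Sup {}\<bar> + 1):]"]) (simp del: of_real_add)
  then show ?thesis
    unfolding polynomial_hull_def by blast
qed

lemma compact_polynomial_hull:
  assumes "bounded S"
  shows "compact (polynomial_hull S)"
proof -
  have "polynomial_hull S = (\<Inter>p. {z. cmod (poly p z) \<le> (SUP w\<in>S. cmod (poly p w))})"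
    by (auto simp: polynomial_hull_def)
  moreover have "closed {z. cmod (poly p z) \<le> (SUP w\<in>S. cmod (poly p w))}" for p
    by (intro closed_Collect_le continuous_intros)
  ultimately have "closed (polynomial_hull S)"
    by auto
  moreover have "cmod z \<le> (SUP w\<in>S. cmod w)" if "z \<in> polynomial_hull S" for z
    \<comment> \<open>The polynomial z itself bounds the hull.\<close>
    using that[unfolded polynomial_hull_def, simplified, rule_format, of "[:0, 1:]"] by simp
  then have "bounded (polynomial_hull S)"
    by (auto simp: bounded_iff)
  ultimately show ?thesis
    by (simp add: compact_eq_bounded_closed)
qed

text \<open>A bounded component of the complement would have its frontier in the hull; the maximum
  principle would then place the whole component in the hull.\<close>

lemma connected_Compl_polynomial_hull:
  assumes "bounded S"
  shows "connected (- polynomial_hull S)"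
proof (rule ccontr)
  assume "\<not> connected (- polynomial_hull S)"
  then obtain C where C: "C \<in> components (- polynomial_hull S)" "bounded C"
    using cobounded_has_bounded_component[of "- polynomial_hull S"]
      compact_imp_bounded[OF compact_polynomial_hull[OF assms]] by auto
  have fr: "frontier C \<subseteq> polynomial_hull S"
    using frontier_of_components_closed_complement[OF _ C(1)]
      compact_imp_closed[OF compact_polynomial_hull[OF assms]] by blast
  obtain z where z: "z \<in> C"
    using in_components_nonempty[OF C(1)] by blast
  have "cmod (poly p z) \<le> (SUP w\<in>S. cmod (poly p w))" for p
    by (rule maximum_modulus_frontier[OF _ _ C(2) _ z])
       (use fr in \<open>auto intro!: holomorphic_intros continuous_intros simp: polynomial_hull_def\<close>)
  then have "z \<in> polynomial_hull S"
    by (simp add: polynomial_hull_def)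
  then show False
    using z in_components_subset[OF C(1)] by auto
qed

text \<open>Some polynomial polyhedron contains the first hull and misses the second. Finitely many
  of its components cover the first hull, and the sum of their indicators, which is 1 on it and 0 on
  the second, is a uniform limit of polynomials on the union.\<close>

lemma polynomial_hulls_separated:
  assumes S: "bounded S" "S \<noteq> {}" and T: "bounded T" "T \<noteq> {}"
    and disj: "polynomial_hull S \<inter> polynomial_hull T = {}" and "e > 0"
  obtains p where "\<And>z. z \<in> polynomial_hull S \<Longrightarrow> cmod (poly p z - 1) < e"
    "\<And>z. z \<in> polynomial_hull T \<Longrightarrow> cmod (poly p z) < e"
proof -
  define K L where "K = polynomial_hull S" and "L = polynomial_hull T"
  define X where "X = K \<union> L"
  have K: "compact K" "connected (- K)" and L: "compact L" "connected (- L)" "L \<noteq> {}"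
    using compact_polynomial_hull connected_Compl_polynomial_hull S T subset_polynomial_hull[OF T(1)]
    by (auto simp: K_def L_def)
  have KL: "K \<inter> L = {}"
    using disj by (simp add: K_def L_def)
  \<comment> \<open>Janiszewski's theorem applies because \<open>K \<inter> L\<close> is empty and
    therefore connected.\<close>
  have X: "compact X" "connected (- X)"
    using K L KL Janiszewski_connected[of K L] by (auto simp: X_def compact_imp_closed)
  have sep: "\<exists>p. cmod (poly p w) > 1 \<and> (\<forall>z\<in>K. cmod (poly p z) < 1)" if "w \<in> L" for w
  proof -
    have "w \<notin> K" using that KL by auto
    then obtain q where q: "cmod (poly q w) > (SUP z\<in>S. cmod (poly q z))"
      by (auto simp: K_def polynomial_hull_def not_le)
    define s where "s = (SUP z\<in>S. cmod (poly q z))"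
    have "0 \<le> s"
      using S cmod_poly_le_SUP[OF S(1)] unfolding s_def by (meson all_not_in_conv norm_ge_zero order_trans)
    \<comment> \<open>Any value strictly between \<open>s\<close>, which bounds \<open>q\<close> on
      the hull \<open>K\<close>, and \<open>cmod (poly q w)\<close> would do; dividing
      \<open>q\<close> by it moves the threshold to 1.\<close>
    define c where "c = (s + cmod (poly q w)) / 2"
    have c: "s < c" "c < cmod (poly q w)" "0 < c"
      using q \<open>0 \<le> s\<close> by (auto simp: c_def s_def)
    have "cmod (poly q z) < c" if "z \<in> K" for z
      using that c(1) order.strict_trans1 unfolding K_def polynomial_hull_def s_def by blast
    then show ?thesis
      using c by (intro exI[of _ "smult (of_real (1 / c)) q"]) (auto simp: norm_mult norm_divide field_simps)
  qed
  then obtain P where P: "\<And>w. w \<in> L \<Longrightarrow> cmod (poly (P w) w) > 1"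
      "\<And>w z. w \<in> L \<Longrightarrow> z \<in> K \<Longrightarrow> cmod (poly (P w) z) < 1"
    by metis
  have "open {z. cmod (poly (P w) z) > 1}" for w
    by (intro open_Collect_less continuous_intros)
  moreover have "L \<subseteq> (\<Union>w\<in>L. {z. cmod (poly (P w) z) > 1})"
    using P(1) by auto
  ultimately obtain W where W: "W \<subseteq> L" "finite W" "L \<subseteq> (\<Union>w\<in>W. {z. cmod (poly (P w) z) > 1})"
    using compactE_image[OF L(1), of L "\<lambda>w. {z. cmod (poly (P w) z) > 1}"] by metis
  define F where "F = P ` W"
  define \<Omega> where "\<Omega> = {z. \<forall>p\<in>F. cmod (poly p z) < 1}"
  have "finite F"
    using W by (simp add: F_def)
  have K\<Omega>: "K \<subseteq> \<Omega>"
    using P(2) W(1) by (auto simp: \<Omega>_def F_def)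
  have L\<Omega>: "L \<inter> \<Omega> = {}"
    using W(3) by (fastforce simp: \<Omega>_def F_def)
  have comp: "open V" "simply_connected V" if "V \<in> components \<Omega>" for V
    using simply_connected_component_poly_polyhedron[OF \<open>finite F\<close>] that unfolding \<Omega>_def by blast+
  have "K \<subseteq> \<Union> (components \<Omega>)"
    using K\<Omega> by simp
  then obtain \<V> where \<V>: "\<V> \<subseteq> components \<Omega>" "finite \<V>" "K \<subseteq> \<Union> \<V>"
    using compactE[OF K(1), of "components \<Omega>"] comp(1) by metis
  have "poly_approximable X (\<lambda>z. \<Sum>V\<in>\<V>. if z \<in> V then 1 else 0)"
  proof (rule poly_approximable_sum)
    fix V assume "V \<in> \<V>"
    then have V: "V \<in> components \<Omega>"
      using \<V>(1) by auto
    \<comment> \<open>Removing the other open components from \<open>K\<close> shows that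
      \<open>X \<inter> V\<close> is closed.\<close>
    have "X \<inter> V = K - \<Union> (components \<Omega> - {V})"
      using in_components_subset[OF V] L\<Omega> K\<Omega> Union_components[of \<Omega>] components_nonoverlap[OF V]
      unfolding X_def by blast
    moreover have "open (\<Union> (components \<Omega> - {V}))"
      using comp(1) by auto
    ultimately have "compact (X \<inter> V)"
      using K(1) by (simp add: compact_diff)
    moreover have "V \<noteq> UNIV"
      using in_components_subset[OF V] L\<Omega> L(3) by auto
    ultimately show "poly_approximable X (\<lambda>z. if z \<in> V then 1 else 0)"
      using comp[OF V] X by (intro poly_approximable_indicator_simply_connected)
  qed
  then obtain p where p: "\<And>z. z \<in> X \<Longrightarrow> cmod (poly p z - (\<Sum>V\<in>\<V>. if z \<in> V then 1 else 0)) < e"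
    using poly_approximableD \<open>e > 0\<close> by blast
  show thesis
  proof
    fix z assume "z \<in> polynomial_hull S"
    then have z: "z \<in> K" by (simp add: K_def)
    then obtain U where U: "U \<in> \<V>" "z \<in> U"
      using \<V>(3) by auto
    \<comment> \<open>Components are disjoint, so exactly one summand is 1.\<close>
    have "(z \<in> V) = (V = U)" if "V \<in> \<V>" for V
      using components_nonoverlap[of V \<Omega> U] that U \<V>(1) by auto
    then have "(\<Sum>V\<in>\<V>. if z \<in> V then 1 else 0) = (\<Sum>V\<in>\<V>. if V = U then 1 else 0 :: complex)"
      by (intro sum.cong) auto
    also have "\<dots> = 1"
      using U \<V>(2) by simp
    finally show "cmod (poly p z - 1) < e"
      using p[of z] z by (simp add: X_def)
  next
    fix z assume "z \<in> polynomial_hull T"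
    then have z: "z \<in> L" by (simp add: L_def)
    then have "(\<Sum>V\<in>\<V>. if z \<in> V then 1 else 0 :: complex) = 0"
      using L\<Omega> \<V>(1) in_components_subset by (intro sum.neutral) fastforce
    then show "cmod (poly p z) < e"
      using p[of z] z by (simp add: X_def)
  qed
qed

text \<open>The values of \<open>p\<close> on \<open>S\<close> form a compact subset of the right
  half plane, hence lie in a disc of centre and radius \<open>R\<close> for large \<open>R\<close>.
  The bound on p - R is a condition on the modulus of a polynomial, so it passes to the
  hull.\<close>

lemma Re_poly_pos_polynomial_hull:
  assumes S: "compact S" and pos: "\<And>w. w \<in> S \<Longrightarrow> Re (poly p w) > 0"
    and z: "z \<in> polynomial_hull S"
  shows "Re (poly p z) > 0"
proof -
  have ne: "S \<noteq> {}"
    using z polynomial_hull_empty by auto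
  have "continuous_on S (\<lambda>w. Re (poly p w))" "continuous_on S (\<lambda>w. cmod (poly p w))"
    by (intro continuous_intros)+
  then obtain u v where u: "u \<in> S" "\<And>w. w \<in> S \<Longrightarrow> Re (poly p u) \<le> Re (poly p w)"
    and v: "v \<in> S" "\<And>w. w \<in> S \<Longrightarrow> cmod (poly p w) \<le> cmod (poly p v)"
    using continuous_attains_inf[OF S ne] continuous_attains_sup[OF S ne] by metis
  define m B where "m = Re (poly p u)" and "B = cmod (poly p v)"
  have m: "m > 0" using pos u(1) by (simp add: m_def)
  have B: "B > 0" using pos[OF v(1)] by (auto simp: B_def)
  \<comment> \<open>Expanding the square, the squared modulus of p - R is at most B^2 - 2 R m + R^2.
    With R m = B^2 this is R^2 - B^2, below R^2.\<close>
  define R where "R = B\<^sup>2 / m"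
  have R: "R > 0" using m B by (simp add: R_def)
  have disc: "cmod (poly p w - of_real R) < R" if "w \<in> S" for w
  proof -
    have "(cmod (poly p w))\<^sup>2 \<le> B\<^sup>2"
      using v(2)[OF that] by (intro power_mono) (auto simp: B_def)
    moreover have "R * m \<le> R * Re (poly p w)"
      using u(2)[OF that] R by (simp add: m_def)
    moreover have "R * m = B\<^sup>2" "B\<^sup>2 > 0"
      using m B by (simp_all add: R_def)
    moreover have "(cmod (poly p w - of_real R))\<^sup>2 = (cmod (poly p w))\<^sup>2 - 2 * (R * Re (poly p w)) + R\<^sup>2"
      unfolding cmod_power2 by (simp add: power2_eq_square algebra_simps)
    ultimately have "(cmod (poly p w - of_real R))\<^sup>2 < R\<^sup>2"
      by linarith
    then show ?thesis
      using R by (simp add: power_less_imp_less_base)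
  qed
  define q where "q = p - [:of_real R:]"
  have "continuous_on S (\<lambda>w. cmod (poly q w))"
    by (intro continuous_intros)
  then obtain w where w: "w \<in> S" "\<And>x. x \<in> S \<Longrightarrow> cmod (poly q x) \<le> cmod (poly q w)"
    using continuous_attains_sup[OF S ne] by metis
  have "cmod (poly q z) \<le> (SUP x\<in>S. cmod (poly q x))"
    using z unfolding polynomial_hull_def by blast
  also have "\<dots> \<le> cmod (poly q w)"
    using w(2) ne by (intro cSUP_least)
  also have "\<dots> < R"
    using disc[OF w(1)] by (simp add: q_def)
  finally have "cmod (poly p z - of_real R) < R"
    by (simp add: q_def)
  then show ?thesis
    using abs_Re_le_cmod[of "poly p z - of_real R"] by auto
qed

section \<open>Separation of spectra by half planes\<close>

theorem theorem1p6:
  fixes A :: "'a::complex_banach \<Rightarrow> 'a" and B :: "'b::complex_banach \<Rightarrow> 'b"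
  assumes "A \<in> bounded_operators" and "B \<in> bounded_operators"
  shows "(\<exists>p :: complex poly. spectrum (poly_op p A) \<subseteq> {z. Re z > 0} \<and>
                              spectrum (poly_op p B) \<subseteq> {z. Re z < 0}) \<longleftrightarrow>
         polynomial_hull (spectrum A) \<inter> polynomial_hull (spectrum B) = {}"
proof
  assume "\<exists>p :: complex poly. spectrum (poly_op p A) \<subseteq> {z. Re z > 0} \<and>
                              spectrum (poly_op p B) \<subseteq> {z. Re z < 0}"
  then obtain p :: "complex poly" where p: "spectrum (poly_op p A) \<subseteq> {z. Re z > 0}"
      "spectrum (poly_op p B) \<subseteq> {z. Re z < 0}"
    by blast
  have "Re (poly p z) > 0" if "z \<in> polynomial_hull (spectrum A)" for z
    using poly_spectrum_subset[OF assms(1), of p] p(1)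
    by (intro Re_poly_pos_polynomial_hull[OF compact_spectrum[OF assms(1)] _ that]) auto
  moreover have "Re (poly (- p) z) > 0" if "z \<in> polynomial_hull (spectrum B)" for z
    using poly_spectrum_subset[OF assms(2), of p] p(2)
    by (intro Re_poly_pos_polynomial_hull[OF compact_spectrum[OF assms(2)] _ that]) auto
  ultimately show "polynomial_hull (spectrum A) \<inter> polynomial_hull (spectrum B) = {}"
    by fastforce
next
  assume disj: "polynomial_hull (spectrum A) \<inter> polynomial_hull (spectrum B) = {}"
  note bdd = compact_spectrum[OF assms(1), THEN compact_imp_bounded]
    compact_spectrum[OF assms(2), THEN compact_imp_bounded]
  \<comment> \<open>Positive degree is demanded because the inclusion
    \<open>spectrum_poly_op_subset\<close> is applied to \<open>p\<close>.\<close>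
  have "\<exists>p :: complex poly. degree p > 0 \<and> (\<forall>z\<in>spectrum A. Re (poly p z) > 0) \<and>
      (\<forall>z\<in>spectrum B. Re (poly p z) < 0)"
  \<comment> \<open>An empty spectrum occurs on the zero space. Then only one half-plane condition
    is left at most, and a linear polynomial shifted by more than the spectral bound meets
    it.\<close>
  proof (cases "spectrum A = {} \<or> spectrum B = {}")
    case True
    obtain M where M: "\<And>z. z \<in> spectrum A \<union> spectrum B \<Longrightarrow> cmod z \<le> M"
      using bdd by (metis bounded_Un bounded_iff)
    have less: "\<bar>Re z\<bar> < M + 1" if "z \<in> spectrum A \<union> spectrum B" for z
      using M[OF that] abs_Re_le_cmod[of z] by linarith
    from True show ?thesis
    proof
      assume "spectrum A = {}"
      then show ?thesis
        using less by (intro exI[of _ "[:- of_real (M + 1), 1:]"]) fastforce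
    next
      assume "spectrum B = {}"
      then show ?thesis
        using less by (intro exI[of _ "[:of_real (M + 1), 1:]"]) fastforce
    qed
  next
    case False
    then obtain p where p: "\<And>z. z \<in> polynomial_hull (spectrum A) \<Longrightarrow> cmod (poly p z - 1) < 1 / 2"
        "\<And>z. z \<in> polynomial_hull (spectrum B) \<Longrightarrow> cmod (poly p z) < 1 / 2"
      using polynomial_hulls_separated[OF bdd(1) _ bdd(2) _ disj, of "1 / 2"] by auto
    \<comment> \<open>As \<open>p\<close> is within 1/2 of 1 on one hull and of 0 on the other,
      subtracting 1/2 gives opposite signs of the real part.\<close>
    define q where "q = p - [:1 / 2:]"
    have pos: "Re (poly q z) > 0" if "z \<in> spectrum A" for z
      using p(1)[of z] subset_polynomial_hull[OF bdd(1)] that abs_Re_le_cmod[of "poly p z - 1"]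
      by (auto simp: q_def)
    have neg: "Re (poly q z) < 0" if "z \<in> spectrum B" for z
      using p(2)[of z] subset_polynomial_hull[OF bdd(2)] that abs_Re_le_cmod[of "poly p z"]
      by (auto simp: q_def)
    \<comment> \<open>A constant cannot have real parts of both signs, and both spectra are nonempty
      here.\<close>
    have "degree q \<noteq> 0"
    proof
      assume "degree q = 0"
      then obtain c where "q = [:c:]"
        by (rule degree_eq_zeroE)
      then show False
        using pos neg False by fastforce
    qed
    then show ?thesis
      using pos neg by blast
  qed
  then obtain p :: "complex poly" where "degree p > 0" "\<forall>z\<in>spectrum A. Re (poly p z) > 0"
      "\<forall>z\<in>spectrum B. Re (poly p z) < 0"
    by blast
  then show "\<exists>p :: complex poly. spectrum (poly_op p A) \<subseteq> {z. Re z > 0} \<and>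
                              spectrum (poly_op p B) \<subseteq> {z. Re z < 0}"
    using spectrum_poly_op_subset[OF assms(1), of p] spectrum_poly_op_subset[OF assms(2), of p]
    by (intro exI[of _ p]) auto
qed

end
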